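(* Let $S$ be a finite group, $p$ a prime, and $A$ a normal subgroup of $S$ of index $p$. Suppose that $H, U \leq A$. Let $t \in S \setminus A$ and denote $H_{j} = H^{t^{j}}$ for $j = 0, 1, \ldots, p-1$. Then \[ \beta_{S/H}(U) = \sum_{j=0}^{p-1} \beta_{A/H_{j}}(U). \] In particular, if $[H]_{S} = [H]_{A}$ then $\beta_{S/H}(U) = p\,\beta_{A/H}(U)$.
   Context: For a finite group $G$, a finite (right) $G$-set $X$ and a subgroup $L \leq G$, the mark is $\beta_{X}(L) = \#\{x \in X : x.l = x \text{ for all } l \in L\}$. For $K \leq G$, $G/K$ is the set of right cosets $Kg$, on which $G$ acts by right multiplication. $H^{s} = s^{-1}Hs$, and $[H]_{G} = \{H^{g} : g \in G\}$. *)

theory Defs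
  imports "HOL-Algebra.Coset" "HOL-Computational_Algebra.Primes"
begin

text \<open>The theory \<open>HOL-Algebra.Group_Action\<close> only has left actions; here
  \<open>act x g\<close> stands for \<open>x.g\<close>.\<close>

locale right_gset =
  group G for G (structure) +
  fixes X :: "'x set" and act :: "'x \<Rightarrow> 'a \<Rightarrow> 'x"
  assumes act_closed: "\<lbrakk> x \<in> X; g \<in> carrier G \<rbrakk> \<Longrightarrow> act x g \<in> X"
    and act_one: "x \<in> X \<Longrightarrow> act x \<one> = x"
    and act_mult: "\<lbrakk> x \<in> X; g \<in> carrier G; h \<in> carrier G \<rbrakk>
      \<Longrightarrow> act x (g \<otimes> h) = act (act x g) h"

text \<open>The group acting on \<open>X\<close> is not an argument, since the set of \<open>L\<close>-fixed points
  only depends on how the elements of \<open>L\<close> act.  The set \<open>X\<close> is meant to be finite.\<close>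

definition mark :: "'x set \<Rightarrow> ('x \<Rightarrow> 'a \<Rightarrow> 'x) \<Rightarrow> 'a set \<Rightarrow> nat" where
  "mark X act L = card {x \<in> X. \<forall>l\<in>L. act x l = x}"

abbreviation coset_mark :: "('a, 'b) monoid_scheme \<Rightarrow> 'a set \<Rightarrow> 'a set \<Rightarrow> nat" where
  "coset_mark G K L \<equiv> mark (rcosets\<^bsub>G\<^esub> K) (\<lambda>C g. C #>\<^bsub>G\<^esub> g) L"

lemma (in group) rcosets_right_gset:
  assumes "subgroup K G"
  shows "right_gset G (rcosets K) (\<lambda>C g. C #> g)"
proof (unfold_locales)
  have K: "K \<subseteq> carrier G"
    using assms by (rule subgroup.subset)
  fix C assume C: "C \<in> rcosets K"
  then obtain a where a: "a \<in> carrier G" "C = K #> a"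
    by (auto simp: RCOSETS_def)
  then have sub: "C \<subseteq> carrier G"
    using K by (simp add: r_coset_subset_G)
  show "C #> \<one> = C"
    using sub by simp
  fix g assume g: "g \<in> carrier G"
  show "C #> g \<in> rcosets K"
    using a g K by (auto simp: coset_mult_assoc RCOSETS_def)
  fix h assume h: "h \<in> carrier G"
  show "C #> (g \<otimes> h) = C #> g #> h"
    using sub g h by (simp add: coset_mult_assoc)
qed

definition conjugate :: "('a, 'b) monoid_scheme \<Rightarrow> 'a set \<Rightarrow> 'a \<Rightarrow> 'a set" where
  "conjugate G H s = (inv\<^bsub>G\<^esub> s <#\<^bsub>G\<^esub> H) #>\<^bsub>G\<^esub> s"

definition conj_class :: "('a, 'b) monoid_scheme \<Rightarrow> 'a set \<Rightarrow> 'a set set" where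
  "conj_class G H = {conjugate G H g | g. g \<in> carrier G}"

end

theory Submission
  imports Defs "HOL-Algebra.Multiplicative_Group"
begin

text \<open>Left multiplication by \<open>x\<close> commutes with the right action and sends \<open>H\<^sup>x a\<close> to \<open>H x a\<close>. Hence
  it identifies the \<open>A\<close>-set \<open>A/H\<^sup>x\<close> with the cosets of \<open>H\<close> in \<open>S\<close> that lie in \<open>A x\<close>. As \<open>S\<close> is the
  disjoint union of the \<open>A t\<^sup>j\<close>, summing over \<open>j\<close> gives the formula; moreover the mark of
  \<open>A/H\<^sup>x\<close> depends only on the coset \<open>A x\<close>, so it is the mark of \<open>A/H\<close> if \<open>H\<^sup>x\<close> is \<open>A\<close>-conjugate to \<open>H\<close>.\<close>

no_notation subset_mset (infix \<open><#\<close> 50)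

lemma r_coset_carrier_update: "C #>\<^bsub>G\<lparr>carrier := A\<rparr>\<^esub> g = C #>\<^bsub>G\<^esub> g"
  by (simp add: r_coset_def)

context group
begin

lemma l_coset_inj_on: "x \<in> carrier G \<Longrightarrow> inj_on (\<lambda>C. x <# C) (Pow (carrier G))"
  by (rule inj_on_inverseI[where g = "\<lambda>C. inv x <# C"]) (auto simp: lcos_m_assoc lcos_mult_one)

lemma conjugate_subset:
  "\<lbrakk> H \<subseteq> carrier G; x \<in> carrier G \<rbrakk> \<Longrightarrow> conjugate G H x \<subseteq> carrier G"
  by (simp add: conjugate_def l_coset_subset_G r_coset_subset_G)

lemma conjugate_one: "H \<subseteq> carrier G \<Longrightarrow> conjugate G H \<one> = H"
  by (simp add: conjugate_def lcos_mult_one)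

text \<open>The leading \<open>x\<close> cancels the \<open>inv x\<close> in front of the conjugate;
  the rest is associativity.\<close>

lemma l_coset_conjugate_r_coset:
  assumes "H \<subseteq> carrier G" "x \<in> carrier G" "a \<in> carrier G"
  shows "x <# (conjugate G H x #> a) = H #> (x \<otimes> a)"
proof -
  have "x <# (conjugate G H x #> a) = x <# (inv x <# H) #> x #> a"
    using assms by (simp add: conjugate_def coset_assoc l_coset_subset_G r_coset_subset_G)
  then show ?thesis
    using assms by (simp add: lcos_m_assoc lcos_mult_one coset_mult_assoc)
qed

text \<open>For \<open>a\<close> in the subgroup \<open>A\<close>, the inverse taken in
  \<open>A\<close> agrees with the one taken in \<open>G\<close>.\<close>

lemma conjugate_subgroup:
  assumes "subgroup A G" "a \<in> A"
  shows "conjugate (G\<lparr>carrier := A\<rparr>) H a = conjugate G H a"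
  using assms by (simp add: conjugate_def m_inv_consistent l_coset_def r_coset_def)

lemma coset_mark_conjugate:
  assumes A: "A \<lhd> G" and H: "subgroup H (G\<lparr>carrier := A\<rparr>)"
    and U: "U \<subseteq> A" and x: "x \<in> carrier G"
  shows "coset_mark (G\<lparr>carrier := A\<rparr>) (conjugate G H x) U
    = card {C \<in> rcosets H. (\<forall>u\<in>U. C #> u = C) \<and> C \<subseteq> A #> x}"
proof -
  interpret A: normal A G by (rule A)
  have HA: "H \<subseteq> A" using subgroup.subset[OF H] by simp
  have "subgroup H G" using H A.subgroup_axioms incl_subgroup by blast
  then interpret H: subgroup H G .
  \<comment> \<open>Normality enters here: elements of \<open>A #> x\<close> can be written as
    \<open>x \<otimes> a\<close> with \<open>a\<close> in \<open>A\<close>, the form that left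
    multiplication by \<open>x\<close> produces.\<close>
  have Ax: "A #> x = x <# A" using A.coset_eq x by blast
  let ?R = "rcosets\<^bsub>G\<lparr>carrier := A\<rparr>\<^esub> (conjugate G H x)"
  have R: "?R = (\<lambda>a. conjugate G H x #> a) ` A"
    by (auto simp: RCOSETS_def r_coset_carrier_update)
  have sub: "C \<subseteq> carrier G" if C: "C \<in> ?R" for C
  proof -
    obtain a where "a \<in> A" "C = conjugate G H x #> a" using C unfolding R by blast
    then show ?thesis
      using x by (simp add: r_coset_subset_G conjugate_subset H.subset)
  qed
  have inj: "(x <# C = x <# D) = (C = D)" if "C \<subseteq> carrier G" "D \<subseteq> carrier G" for C D
    using inj_onD[OF l_coset_inj_on[OF x]] that by blast
  have image: "{C \<in> rcosets H. C \<subseteq> A #> x} = (\<lambda>C. x <# C) ` ?R"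
  proof (intro equalityI subsetI)
    fix C assume "C \<in> {C \<in> rcosets H. C \<subseteq> A #> x}"
    then obtain s where s: "s \<in> carrier G" "C = H #> s" "H #> s \<subseteq> A #> x"
      by (auto simp: RCOSETS_def)
    \<comment> \<open>The representative \<open>s\<close> lies in its own coset
      \<open>H #> s\<close>, hence in \<open>A #> x\<close>.\<close>
    then have "s \<in> x <# A" using Ax rcos_self[OF _ H.subgroup_axioms] by blast
    then obtain a where "a \<in> A" "s = x \<otimes> a" by (auto simp: l_coset_def)
    then show "C \<in> (\<lambda>C. x <# C) ` ?R"
      using s x H.subset by (auto simp: R image_image l_coset_conjugate_r_coset)
  next
    fix C assume "C \<in> (\<lambda>C. x <# C) ` ?R"
    then obtain a where a: "a \<in> A" "C = H #> (x \<otimes> a)"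
      using x H.subset by (auto simp: R l_coset_conjugate_r_coset)
    then have "x \<otimes> a \<in> A #> x" by (auto simp: Ax l_coset_def)
    then have "A #> (x \<otimes> a) = A #> x"
      using repr_independence A.subgroup_axioms x by metis
    \<comment> \<open>Since \<open>H\<close> lies in \<open>A\<close>, the coset of \<open>H\<close>
      through \<open>x \<otimes> a\<close> lies in the coset of \<open>A\<close> through it, which
      is \<open>A #> x\<close>.\<close>
    moreover have "C \<subseteq> A #> (x \<otimes> a)" using HA a by (auto simp: r_coset_def)
    ultimately show "C \<in> {C \<in> rcosets H. C \<subseteq> A #> x}"
      using a x by (auto simp: RCOSETS_def)
  qed
  \<comment> \<open>Associativity moves \<open>u\<close> inside, and injectivity of left
    multiplication then cancels \<open>x\<close>.\<close>
  have fixed: "x <# C #> u = x <# C \<longleftrightarrow> C #> u = C" if "C \<in> ?R" "u \<in> U" for C u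
  proof -
    have C: "C \<subseteq> carrier G" and u: "u \<in> carrier G"
      using that U sub by auto
    then show ?thesis
      using x inj[OF r_coset_subset_G[OF C u] C] by (simp add: coset_assoc)
  qed
  have "{C \<in> rcosets H. (\<forall>u\<in>U. C #> u = C) \<and> C \<subseteq> A #> x}
    = {C \<in> {C \<in> rcosets H. C \<subseteq> A #> x}. \<forall>u\<in>U. C #> u = C}"
    by blast
  also have "\<dots> = (\<lambda>C. x <# C) ` {C \<in> ?R. \<forall>u\<in>U. C #> u = C}"
    unfolding image using fixed by auto
  finally have "{C \<in> rcosets H. (\<forall>u\<in>U. C #> u = C) \<and> C \<subseteq> A #> x} = \<dots>" .
  moreover have "inj_on (\<lambda>C. x <# C) {C \<in> ?R. \<forall>u\<in>U. C #> u = C}"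
    using sub by (intro inj_on_subset[OF l_coset_inj_on[OF x]]) auto
  ultimately show ?thesis
    by (simp add: mark_def r_coset_carrier_update card_image)
qed

text \<open>The quotient by \<open>A\<close> has prime order \<open>p\<close>, so the nontrivial
  element \<open>A #> t\<close> generates it and its first \<open>p\<close> powers list every coset
  once.\<close>

lemma rcosets_prime_index:
  assumes p: "prime p" and A: "A \<lhd> G"
    and index: "card (rcosets A) = p" and t: "t \<in> carrier G - A"
  shows "bij_betw (\<lambda>j. A #> t [^] j) {0..p - 1} (rcosets A)"
proof -
  interpret A: normal A G by (rule A)
  interpret Q: group "G Mod A" by (rule A.factorgroup_is_group)
  have carr: "carrier (G Mod A) = rcosets A" by (simp add: FactGroup_def)
  \<comment> \<open>An infinite set would have \<open>card\<close> equal to 0, which is not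
    prime.\<close>
  have finR: "finite (rcosets A)" using p index card.infinite by (metis not_prime_0)
  have tc: "A #> t \<in> carrier (G Mod A)" using t by (auto simp: carr RCOSETS_def)
  have pow: "A #> t [^] j = (A #> t) [^]\<^bsub>G Mod A\<^esub> j" for j :: nat
    using t by (simp add: A.FactGroup_pow)
  \<comment> \<open>The identity of the quotient is \<open>A\<close> itself, whereas
    \<open>A #> t\<close> contains \<open>t\<close>, which is outside \<open>A\<close>.\<close>
  have "A #> t \<noteq> \<one>\<^bsub>G Mod A\<^esub>"
    using t rcos_self[of t A] A.subgroup_axioms by auto
  then have "Q.ord (A #> t) \<noteq> 1" using Q.ord_eq_1[OF tc] by simp
  moreover have "Q.ord (A #> t) dvd p"
    using Q.ord_dvd_group_order[OF tc] index by (simp add: order_def carr)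
  ultimately have "Q.ord (A #> t) = p" using p by (metis prime_nat_iff)
  then have inj: "inj_on (\<lambda>j. A #> t [^] j) {0..p - 1}"
    using Q.ord_inj[OF tc] by (simp add: pow)
  moreover have "(\<lambda>j. A #> t [^] j) ` {0..p - 1} \<subseteq> rcosets A"
    using t by (auto simp: RCOSETS_def)
  \<comment> \<open>Distinct cosets, \<open>p\<close> in number, exhaust a set of size
    \<open>p\<close>; positivity of \<open>p\<close> ensures that \<open>{0..p - 1}\<close> has
    exactly \<open>p\<close> elements.\<close>
  then have "(\<lambda>j. A #> t [^] j) ` {0..p - 1} = rcosets A"
    using finR prime_gt_0_nat[OF p] card_image[OF inj] index by (intro card_subset_eq) auto
  ultimately show ?thesis by (simp add: bij_betw_def)
qed

text \<open>Existence comes from enlarging \<open>H\<close> to \<open>A\<close> around a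
  representative \<open>s\<close>; uniqueness holds because any coset of \<open>A\<close> containing
  \<open>C\<close> contains \<open>s\<close>, and cosets of \<open>A\<close> through
  \<open>s\<close> coincide.\<close>

lemma rcosets_subset_unique:
  assumes A: "subgroup A G" and "subgroup H G" "H \<subseteq> A" and C: "C \<in> rcosets H"
  shows "\<exists>!D. D \<in> rcosets A \<and> C \<subseteq> D"
proof -
  obtain s where s: "s \<in> carrier G" "C = H #> s" using C by (auto simp: RCOSETS_def)
  then have "s \<in> C" "C \<subseteq> A #> s" "A #> s \<in> rcosets A"
    using assms rcos_self[OF s(1)] by (auto simp: r_coset_def RCOSETS_def)
  moreover have "D = A #> s" if "D \<in> rcosets A" "s \<in> D" for D
    using that A repr_independence by (auto simp: RCOSETS_def)
  ultimately show ?thesis by blast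
qed

end

theorem proposition4p1:
  fixes S :: "('a, 'b) monoid_scheme" and p :: nat and A H U :: "'a set" and t :: 'a
  assumes "group S" and "finite (carrier S)"
    and "prime p"
    and "A \<lhd> S" and "card (rcosets\<^bsub>S\<^esub> A) = p"
    and "subgroup H (S\<lparr>carrier := A\<rparr>)" and "subgroup U (S\<lparr>carrier := A\<rparr>)"
    and "t \<in> carrier S - A"
  shows "coset_mark S H U =
           (\<Sum>j = 0..p - 1. coset_mark (S\<lparr>carrier := A\<rparr>) (conjugate S H (t [^]\<^bsub>S\<^esub> j)) U)
         \<and> (conj_class S H = conj_class (S\<lparr>carrier := A\<rparr>) H \<longrightarrow>
             coset_mark S H U = p * coset_mark (S\<lparr>carrier := A\<rparr>) H U)"
proof -
  interpret group S by (rule assms(1))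
  interpret A: normal A S by (rule assms(4))
  have HA: "H \<subseteq> A" and UA: "U \<subseteq> A"
    using subgroup.subset[OF assms(6)] subgroup.subset[OF assms(7)] by simp_all
  have H: "subgroup H S" using assms(6) A.subgroup_axioms incl_subgroup by blast
  define F where "F = {C \<in> rcosets\<^bsub>S\<^esub> H. \<forall>u\<in>U. C #>\<^bsub>S\<^esub> u = C}"
  have mark_conj: "coset_mark (S\<lparr>carrier := A\<rparr>) (conjugate S H x) U = card {C \<in> F. C \<subseteq> A #>\<^bsub>S\<^esub> x}"
    if "x \<in> carrier S" for x
    using coset_mark_conjugate[OF assms(4,6) UA that] by (simp add: F_def)
  have finF: "finite F"
    using assms(2) H by (auto simp: F_def RCOSETS_def)
  have bij: "bij_betw (\<lambda>j. A #>\<^bsub>S\<^esub> t [^]\<^bsub>S\<^esub> j) {0..p - 1} (rcosets\<^bsub>S\<^esub> A)"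
    using assms by (intro rcosets_prime_index)
  have uniq: "\<exists>!D. D \<in> rcosets\<^bsub>S\<^esub> A \<and> C \<subseteq> D" if "C \<in> F" for C
    using that HA by (intro rcosets_subset_unique[OF A.subgroup_axioms H]) (auto simp: F_def)
  have finR: "finite (rcosets\<^bsub>S\<^esub> A)"
    using bij bij_betw_finite by blast
  \<comment> \<open>The fixed cosets are sorted by the coset of \<open>A\<close> containing them;
    \<open>uniq\<close> makes the classes cover \<open>F\<close> and be disjoint.\<close>
  have "F = (\<Union>D \<in> rcosets\<^bsub>S\<^esub> A. {C \<in> F. C \<subseteq> D})"
    using ex1_implies_ex[OF uniq] by auto
  then have "card F = card (\<Union>D \<in> rcosets\<^bsub>S\<^esub> A. {C \<in> F. C \<subseteq> D})"
    by simp
  also have "\<dots> = (\<Sum>D \<in> rcosets\<^bsub>S\<^esub> A. card {C \<in> F. C \<subseteq> D})"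
    using uniq finF finR by (intro card_UN_disjoint) auto
  also have "\<dots> = (\<Sum>j = 0..p - 1. card {C \<in> F. C \<subseteq> A #>\<^bsub>S\<^esub> t [^]\<^bsub>S\<^esub> j})"
    by (rule sum.reindex_bij_betw[OF bij, symmetric])
  also have "\<dots> = (\<Sum>j = 0..p - 1. coset_mark (S\<lparr>carrier := A\<rparr>) (conjugate S H (t [^]\<^bsub>S\<^esub> j)) U)"
    using assms(8) by (intro sum.cong refl mark_conj[symmetric]) simp
  finally have sum: "coset_mark S H U = \<dots>"
    by (simp add: mark_def F_def)
  moreover have "coset_mark S H U = p * coset_mark (S\<lparr>carrier := A\<rparr>) H U"
    if cc: "conj_class S H = conj_class (S\<lparr>carrier := A\<rparr>) H"
  proof -
    have "coset_mark (S\<lparr>carrier := A\<rparr>) (conjugate S H x) U = coset_mark (S\<lparr>carrier := A\<rparr>) H U"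
      if x: "x \<in> carrier S" for x
    proof -
      \<comment> \<open>Equality of the conjugacy classes replaces \<open>x\<close> by some
        \<open>a\<close> in \<open>A\<close> giving the same conjugate of \<open>H\<close>.\<close>
      have "conjugate S H x \<in> conj_class (S\<lparr>carrier := A\<rparr>) H"
        using x unfolding cc[symmetric] by (auto simp: conj_class_def)
      then obtain a where a: "a \<in> A" "conjugate S H x = conjugate S H a"
        by (auto simp: conj_class_def conjugate_subgroup[OF A.subgroup_axioms])
      \<comment> \<open>Both \<open>a\<close> and the identity represent the coset \<open>A\<close>,
        so \<open>mark_conj\<close> gives them the same count.\<close>
      then have "A #>\<^bsub>S\<^esub> a = A #>\<^bsub>S\<^esub> \<one>\<^bsub>S\<^esub>"
        using A.subset by (simp add: coset_join2 A.subgroup_axioms)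
      then have "coset_mark (S\<lparr>carrier := A\<rparr>) (conjugate S H a) U
        = coset_mark (S\<lparr>carrier := A\<rparr>) (conjugate S H \<one>\<^bsub>S\<^esub>) U"
        using mark_conj[of a] mark_conj[of "\<one>\<^bsub>S\<^esub>"] a(1) by simp
      then show ?thesis
        using a(2) HA A.subset by (simp add: conjugate_one)
    qed
    \<comment> \<open>All summands agree, and there are \<open>p\<close> of them because
      \<open>p\<close> is positive.\<close>
    then show ?thesis
      using sum assms(8) prime_gt_0_nat[OF assms(3)] by simp
  qed
  ultimately show ?thesis by blast
qed

end
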